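(* The following three statements hold. (1) There exist a mean-payoff game $\mathcal{G}$ and a strategy $\sigma_0\in\Sigma_0(\mathcal{G})$ of Player 0 such that $\mathsf{BR}_1(\sigma_0)=\varnothing$. (2) For all mean-payoff games $\mathcal{G}$ and all finite memory strategies $\sigma_0$ of Player 0 in $\mathcal{G}$, $\mathsf{BR}_1(\sigma_0)\neq\varnothing$. (3) For all mean-payoff games $\mathcal{G}$, all strategies $\sigma_0\in\Sigma_0(\mathcal{G})$ and all $\epsilon>0$, $\mathsf{BR}_1^{\epsilon}(\sigma_0)\neq\varnothing$.
   Context: A (bi-weighted) arena $\mathcal{A}=(V,E,\langle V_0,V_1\rangle,w_0,w_1)$ consists of a finite set $V$ of vertices, a set $E\subseteq V\times V$ of edges such that every vertex has at least one outgoing edge, a partition $\langle V_0,V_1\rangle$ of $V$ ($V_i$ is owned by Player $i$), and two weight functions $w_0,w_1:E\to\mathbb{Z}$. A play is an infinite path $\pi=\pi_0\pi_1\dots$ of the arena; a history is a non-empty finite prefix of a play; $w_i(h)$ is the sum of the $w_i$-weights of the edges of a history $h$. Mean-payoff game: the payoff of Player $i\in\{0,1\}$ for a play $\pi$ is $\underline{\mathsf{MP}}_i(\pi)=\liminf_{k\to\infty}\frac1k w_i(\pi_0\dots\pi_k)$. A strategy of Player $i$ is a function mapping each history ending in a vertex $u\in V_i$ to a successor of $u$; $\Sigma_i=\Sigma_i(\mathcal{G})$ is the set of all strategies of Player $i$. A strategy has finite memory if it can be realized as the output of a finite state machine. For $v\in V$, $\mathsf{Out}_v(\sigma_0,\sigma_1)$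 is the unique play starting in $v$ in which both players follow their strategies. Best-responses of Player 1 to $\sigma_0$: $\mathsf{BR}_1(\sigma_0)=\{\sigma_1\in\Sigma_1\mid \forall v\in V\ \forall\sigma_1'\in\Sigma_1:\ \underline{\mathsf{MP}}_1(\mathsf{Out}_v(\sigma_0,\sigma_1))\ge\underline{\mathsf{MP}}_1(\mathsf{Out}_v(\sigma_0,\sigma_1'))\}$. $\epsilon$-best-responses: $\mathsf{BR}_1^{\epsilon}(\sigma_0)=\{\sigma_1\in\Sigma_1\mid \forall v\in V\ \forall\sigma_1'\in\Sigma_1:\ \underline{\mathsf{MP}}_1(\mathsf{Out}_v(\sigma_0,\sigma_1))\ge\underline{\mathsf{MP}}_1(\mathsf{Out}_v(\sigma_0,\sigma_1'))-\epsilon\}$. *)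

theory Defs
  imports Complex_Main "HOL-Library.FuncSet" "HOL-Library.Extended_Real" "HOL-Library.Liminf_Limsup"
begin

datatype player = P0 | P1

record 'v bi_arena =
  verts :: "'v set"
  edges :: "('v \<times> 'v) set"
  owned :: "player \<Rightarrow> 'v set"
  wt :: "player \<Rightarrow> 'v \<times> 'v \<Rightarrow> int"  \<comment> \<open>only the values on edges are ever used\<close>

definition arena :: "'v bi_arena \<Rightarrow> bool" where
  "arena G \<longleftrightarrow>
     finite (verts G) \<and>
     edges G \<subseteq> verts G \<times> verts G \<and>
     (\<forall>v\<in>verts G. \<exists>u. (v, u) \<in> edges G) \<and>
     owned G P0 \<union> owned G P1 = verts G \<and>
     owned G P0 \<inter> owned G P1 = {}"

definition play :: "'v bi_arena \<Rightarrow> (nat \<Rightarrow> 'v) \<Rightarrow> bool" where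
  "play G \<pi> \<longleftrightarrow> (\<forall>k. (\<pi> k, \<pi> (Suc k)) \<in> edges G)"

text \<open>\<open>prefix_of \<pi> k\<close> is the history with vertices \<open>\<pi> 0, \<dots>, \<pi> k\<close>, that is, with \<open>k\<close> edges.\<close>

definition prefix_of :: "(nat \<Rightarrow> 'v) \<Rightarrow> nat \<Rightarrow> 'v list" where
  "prefix_of \<pi> k = map \<pi> [0..<Suc k]"

definition histories :: "'v bi_arena \<Rightarrow> 'v list set" where
  "histories G = {prefix_of \<pi> k | \<pi> k. play G \<pi>}"

definition histories_of :: "'v bi_arena \<Rightarrow> player \<Rightarrow> 'v list set" where
  "histories_of G i = {h \<in> histories G. last h \<in> owned G i}"

definition hist_wt :: "'v bi_arena \<Rightarrow> player \<Rightarrow> 'v list \<Rightarrow> int" where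
  "hist_wt G i h = (\<Sum>j<length h - 1. wt G i (h ! j, h ! Suc j))"

text \<open>The term for \<open>k = 0\<close> is \<open>0 / 0 = 0\<close>; it does not affect the limit inferior.\<close>

definition MP :: "'v bi_arena \<Rightarrow> player \<Rightarrow> (nat \<Rightarrow> 'v) \<Rightarrow> ereal" where
  "MP G i \<pi> = liminf (\<lambda>k. ereal (real_of_int (hist_wt G i (prefix_of \<pi> k)) / real k))"

definition strategies :: "'v bi_arena \<Rightarrow> player \<Rightarrow> ('v list \<Rightarrow> 'v) set" where
  "strategies G i = (\<Pi>\<^sub>E h\<in>histories_of G i. {u. (last h, u) \<in> edges G})"

text \<open>
  Finite memory: the strategy is the output function of a deterministic finite automaton that
  updates its state on every vertex read, and whose output at a history depends on the state
  reached on the vertices before the last one and on the last vertex. States are natural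
  numbers without loss of generality, since the state set is finite.
\<close>

definition finite_memory :: "'v bi_arena \<Rightarrow> player \<Rightarrow> ('v list \<Rightarrow> 'v) \<Rightarrow> bool" where
  "finite_memory G i \<sigma> \<longleftrightarrow>
     (\<exists>(M :: nat set) m\<^sub>0 upd out.
        finite M \<and> m\<^sub>0 \<in> M \<and> (\<forall>m\<in>M. \<forall>v\<in>verts G. upd m v \<in> M) \<and>
        (\<forall>h\<in>histories_of G i. \<sigma> h = out (foldl upd m\<^sub>0 (butlast h)) (last h)))"

definition follows :: "'v bi_arena \<Rightarrow> player \<Rightarrow> ('v list \<Rightarrow> 'v) \<Rightarrow> (nat \<Rightarrow> 'v) \<Rightarrow> bool" where
  "follows G i \<sigma> \<pi> \<longleftrightarrow> (\<forall>k. \<pi> k \<in> owned G i \<longrightarrow> \<pi> (Suc k) = \<sigma> (prefix_of \<pi> k))"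

definition is_outcome ::
    "'v bi_arena \<Rightarrow> 'v \<Rightarrow> ('v list \<Rightarrow> 'v) \<Rightarrow> ('v list \<Rightarrow> 'v) \<Rightarrow> (nat \<Rightarrow> 'v) \<Rightarrow> bool" where
  "is_outcome G v \<sigma>\<^sub>0 \<sigma>\<^sub>1 \<pi> \<longleftrightarrow>
     play G \<pi> \<and> \<pi> 0 = v \<and> follows G P0 \<sigma>\<^sub>0 \<pi> \<and> follows G P1 \<sigma>\<^sub>1 \<pi>"

definition Out ::
    "'v bi_arena \<Rightarrow> 'v \<Rightarrow> ('v list \<Rightarrow> 'v) \<Rightarrow> ('v list \<Rightarrow> 'v) \<Rightarrow> nat \<Rightarrow> 'v" where
  "Out G v \<sigma>\<^sub>0 \<sigma>\<^sub>1 = (THE \<pi>. is_outcome G v \<sigma>\<^sub>0 \<sigma>\<^sub>1 \<pi>)"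

definition BR1 :: "'v bi_arena \<Rightarrow> ('v list \<Rightarrow> 'v) \<Rightarrow> ('v list \<Rightarrow> 'v) set" where
  "BR1 G \<sigma>\<^sub>0 = {\<sigma>\<^sub>1 \<in> strategies G P1. \<forall>v\<in>verts G. \<forall>\<sigma>\<^sub>1'\<in>strategies G P1.
     MP G P1 (Out G v \<sigma>\<^sub>0 \<sigma>\<^sub>1) \<ge> MP G P1 (Out G v \<sigma>\<^sub>0 \<sigma>\<^sub>1')}"

definition BR1_eps :: "'v bi_arena \<Rightarrow> real \<Rightarrow> ('v list \<Rightarrow> 'v) \<Rightarrow> ('v list \<Rightarrow> 'v) set" where
  "BR1_eps G \<epsilon> \<sigma>\<^sub>0 = {\<sigma>\<^sub>1 \<in> strategies G P1. \<forall>v\<in>verts G. \<forall>\<sigma>\<^sub>1'\<in>strategies G P1.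
     MP G P1 (Out G v \<sigma>\<^sub>0 \<sigma>\<^sub>1) \<ge> MP G P1 (Out G v \<sigma>\<^sub>0 \<sigma>\<^sub>1') - ereal \<epsilon>}"

text \<open>The definite description in \<open>Out\<close> is well defined.\<close>

lemma prefix_of_Suc: "prefix_of \<pi> (Suc k) = prefix_of \<pi> k @ [\<pi> (Suc k)]"
  by (simp add: prefix_of_def)

lemma last_prefix_of [simp]: "last (prefix_of \<pi> k) = \<pi> k"
  by (simp add: prefix_of_def)

lemma strategy_step:
  assumes "\<sigma> \<in> strategies G i" "h \<in> histories_of G i"
  shows "(last h, \<sigma> h) \<in> edges G"
  using PiE_mem[OF assms(1)[unfolded strategies_def] assms(2)] by simp

lemma walk_in_histories:
  assumes G: "arena G" and v: "p 0 \<in> verts G"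
    and e: "\<And>j. j < k \<Longrightarrow> (p j, p (Suc j)) \<in> edges G"
  shows "prefix_of p k \<in> histories G"
proof -
  from G have "\<forall>u\<in>verts G. \<exists>u'. (u, u') \<in> edges G"
    by (simp add: arena_def)
  then obtain s where s: "\<And>u. u \<in> verts G \<Longrightarrow> (u, s u) \<in> edges G"
    by metis
  have sub: "edges G \<subseteq> verts G \<times> verts G"
    using G by (simp add: arena_def)
  have pk: "p k \<in> verts G"
    using v e[of "k - 1"] sub by (cases k) auto
  have it: "(s ^^ n) (p k) \<in> verts G" for n
    by (induction n) (use pk s sub in auto)
  define q where "q j = (if j \<le> k then p j else (s ^^ (j - k)) (p k))" for j
  have "(q j, q (Suc j)) \<in> edges G" for j
  proof (cases "j < k")
    case True
    then show ?thesis using e by (simp add: q_def)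
  next
    case False
    then have "q j = (s ^^ (j - k)) (p k)" "q (Suc j) = s ((s ^^ (j - k)) (p k))"
      by (auto simp: q_def Suc_diff_le)
    then show ?thesis using s[OF it] by simp
  qed
  then have "play G q" by (simp add: play_def)
  moreover have "prefix_of p k = prefix_of q k"
    by (auto simp: prefix_of_def q_def)
  ultimately show ?thesis by (auto simp: histories_def)
qed

lemma outcome_unique:
  assumes G: "arena G"
    and a: "is_outcome G v \<sigma>\<^sub>0 \<sigma>\<^sub>1 \<pi>" and b: "is_outcome G v \<sigma>\<^sub>0 \<sigma>\<^sub>1 \<rho>"
  shows "\<pi> = \<rho>"
proof -
  have "prefix_of \<pi> k = prefix_of \<rho> k" for k
  proof (induction k)
    case 0
    then show ?case using a b by (simp add: prefix_of_def is_outcome_def)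
  next
    case (Suc k)
    then have eq: "\<pi> k = \<rho> k" by (metis last_prefix_of)
    have "(\<pi> k, \<pi> (Suc k)) \<in> edges G"
      using a by (simp add: is_outcome_def play_def)
    then have "\<pi> k \<in> owned G P0 \<or> \<pi> k \<in> owned G P1"
      using G by (auto simp: arena_def)
    then have "\<pi> (Suc k) = \<rho> (Suc k)"
      using a b eq Suc.IH by (auto simp: is_outcome_def follows_def)
    with Suc.IH show ?case by (simp add: prefix_of_Suc)
  qed
  then show ?thesis by (metis ext last_prefix_of)
qed

lemma outcome_exists:
  assumes G: "arena G" and v: "v \<in> verts G"
    and s0: "\<sigma>\<^sub>0 \<in> strategies G P0" and s1: "\<sigma>\<^sub>1 \<in> strategies G P1"
  shows "\<exists>\<pi>. is_outcome G v \<sigma>\<^sub>0 \<sigma>\<^sub>1 \<pi>"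
proof -
  define nxt where "nxt h = (if last h \<in> owned G P0 then \<sigma>\<^sub>0 h else \<sigma>\<^sub>1 h)" for h
  define H where "H = rec_nat [v] (\<lambda>_ h. h @ [nxt h])"
  define p where "p k = last (H k)" for k
  have H0: "H 0 = [v]" and HS: "H (Suc k) = H k @ [nxt (H k)]" for k
    by (simp_all add: H_def)
  have HP: "H k = prefix_of p k" for k
  proof (induction k)
    case 0
    then show ?case by (simp add: H0 p_def prefix_of_def)
  next
    case (Suc k)
    have "H (Suc k) = H k @ [p (Suc k)]" by (simp add: HS p_def)
    with Suc.IH show ?case by (simp add: prefix_of_Suc)
  qed
  have p0: "p 0 = v" by (simp add: p_def H0)
  have pS: "p (Suc k) = nxt (prefix_of p k)" for k
    by (simp add: p_def HS flip: HP)
  have e: "(p k, p (Suc k)) \<in> edges G" for k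
  proof (induction k rule: less_induct)
    case (less k)
    have h: "prefix_of p k \<in> histories G"
      by (rule walk_in_histories[OF G]) (use v p0 less in auto)
    have "p k \<in> verts G"
      using v p0 less[of "k - 1"] G by (cases k) (auto simp: arena_def)
    then have "p k \<in> owned G P0 \<or> p k \<in> owned G P1 \<and> p k \<notin> owned G P0"
      using G by (auto simp: arena_def)
    then show ?case
    proof
      assume "p k \<in> owned G P0"
      then show ?thesis
        using strategy_step[OF s0, of "prefix_of p k"] h
        by (simp add: histories_of_def pS nxt_def)
    next
      assume "p k \<in> owned G P1 \<and> p k \<notin> owned G P0"
      then show ?thesis
        using strategy_step[OF s1, of "prefix_of p k"] h
        by (simp add: histories_of_def pS nxt_def)
    qed
  qed
  have "is_outcome G v \<sigma>\<^sub>0 \<sigma>\<^sub>1 p"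
    using e p0 G by (auto simp: is_outcome_def play_def follows_def pS nxt_def arena_def)
  then show ?thesis by blast
qed

lemma Out_is_outcome:
  assumes "arena G" "v \<in> verts G" "\<sigma>\<^sub>0 \<in> strategies G P0" "\<sigma>\<^sub>1 \<in> strategies G P1"
  shows "is_outcome G v \<sigma>\<^sub>0 \<sigma>\<^sub>1 (Out G v \<sigma>\<^sub>0 \<sigma>\<^sub>1)"
  unfolding Out_def
proof (rule theI'[where P = "is_outcome G v \<sigma>\<^sub>0 \<sigma>\<^sub>1"])
  show "\<exists>!\<pi>. is_outcome G v \<sigma>\<^sub>0 \<sigma>\<^sub>1 \<pi>"
    using outcome_exists[OF assms] outcome_unique[OF assms(1)] by blast
qed

end

theory Submission
  imports Defs
begin

text \<open>
  Any choice, for each start vertex, of a play consistent with \<open>\<sigma>\<^sub>0\<close> is realized by a single strategy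
  of Player 1: plays from different vertices have no history in common. So a best response exists
  iff, from every vertex, the supremum of the payoff over the consistent plays is attained, and an
  \<open>\<epsilon>\<close>-best response exists since this supremum is finite. If \<open>\<sigma>\<^sub>0\<close> has finite memory, the
  consistent plays are the walks of a finite product graph, where the maximal mean weight \<open>l\<close> of a
  short reachable cycle is optimal: it is attained by a lasso, and removing short cycles one after
  the other shows that a walk of length \<open>k\<close> weighs at most \<open>l * k + C\<close>. For the counterexample,
  Player 1 may wait for any number \<open>z\<close> of steps before handing over to Player 0, who then makes sure
  that the mean payoff is \<open>z / (z + 1)\<close>; waiting forever yields \<open>0\<close>.
\<close>

section \<open>Averages of sequences\<close>

text \<open>The error \<open>C / k\<close> tends to 0; the index 0, where division by zero yields 0,
  is irrelevant to the limit inferior.\<close>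

lemma liminf_average_le:
  fixes f :: "nat \<Rightarrow> real"
  assumes "\<And>k. f k \<le> l * real k + C"
  shows "liminf (\<lambda>k. ereal (f k / real k)) \<le> ereal l"
proof -
  have "(\<lambda>k. l + C * inverse (real k)) \<longlonglongrightarrow> l + C * 0"
    by (intro tendsto_intros lim_inverse_n)
  then have lim: "(\<lambda>k. ereal (l + C * inverse (real k))) \<longlonglongrightarrow> ereal l"
    by simp
  have "f k / real k \<le> l + C * inverse (real k)" if "k > 0" for k
    using assms[of k] that by (simp add: field_simps)
  then have "eventually (\<lambda>k. ereal (f k / real k) \<le> ereal (l + C * inverse (real k))) sequentially"
    by (auto intro: eventually_mono[OF eventually_gt_at_top[of 0]])
  then have "liminf (\<lambda>k. ereal (f k / real k)) \<le> liminf (\<lambda>k. ereal (l + C * inverse (real k)))"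
    by (rule Liminf_mono)
  also have "\<dots> = ereal l"
    using lim by (intro lim_imp_Liminf) auto
  finally show ?thesis .
qed

lemma liminf_average_ge:
  fixes f :: "nat \<Rightarrow> real"
  assumes "\<And>k. f k \<ge> l * real k - C"
  shows "liminf (\<lambda>k. ereal (f k / real k)) \<ge> ereal l"
proof -
  have "(\<lambda>k. l - C * inverse (real k)) \<longlonglongrightarrow> l - C * 0"
    by (intro tendsto_intros lim_inverse_n)
  then have lim: "(\<lambda>k. ereal (l - C * inverse (real k))) \<longlonglongrightarrow> ereal l"
    by simp
  have "l - C * inverse (real k) \<le> f k / real k" if "k > 0" for k
    using divide_right_mono[OF assms[of k], of "real k"] that by (simp add: diff_divide_distrib flip: divide_inverse)
  then have "eventually (\<lambda>k. ereal (l - C * inverse (real k)) \<le> ereal (f k / real k)) sequentially"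
    by (auto intro: eventually_mono[OF eventually_gt_at_top[of 0]])
  then have "liminf (\<lambda>k. ereal (l - C * inverse (real k))) \<le> liminf (\<lambda>k. ereal (f k / real k))"
    by (rule Liminf_mono)
  moreover have "liminf (\<lambda>k. ereal (l - C * inverse (real k))) = ereal l"
    using lim by (intro lim_imp_Liminf) auto
  ultimately show ?thesis by simp
qed

lemma sum_window_periodic:
  fixes f :: "nat \<Rightarrow> real"
  assumes "\<And>t. t \<ge> j \<Longrightarrow> f (t + n) = f t" "j \<le> k"
  shows "sum f {k..<k+n} = sum f {j..<j+n}"
  using assms(2)
proof (induction k rule: dec_induct)
  case (step k)
  have "sum f {k..<Suc k + n} = sum f {Suc k..<Suc k + n} + f k"
    by (simp add: sum.atLeast_Suc_lessThan)
  moreover have "sum f {k..<Suc k + n} = sum f {k..<k + n} + f (k + n)"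
    by simp
  ultimately show ?case using step assms(1)[of k] by simp
qed simp

text \<open>The deviation of the partial sums from \<open>l * k\<close> is itself periodic from
  \<open>j\<close> on, hence bounded, so both average bounds apply with the same slope
  \<open>l\<close>.\<close>

lemma liminf_average_periodic:
  fixes f :: "nat \<Rightarrow> real"
  assumes per: "\<And>t. t \<ge> j \<Longrightarrow> f (t + n) = f t" and n: "n > 0"
  shows "liminf (\<lambda>k. ereal ((\<Sum>t<k. f t) / real k)) = ereal (sum f {j..<j+n} / real n)"
proof -
  define l where "l = sum f {j..<j+n} / real n"
  define D where "D k = (\<Sum>t<k. f t) - l * real k" for k
  have D: "D (k + n) = D k" if "j \<le> k" for k
  proof -
    have "(\<Sum>t<k+n. f t) = (\<Sum>t<k. f t) + sum f {k..<k+n}"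
      unfolding lessThan_atLeast0 by (rule sum.atLeastLessThan_concat[symmetric]) auto
    also have "sum f {k..<k+n} = l * real n"
      using sum_window_periodic[where f = f, OF per that] n by (simp add: l_def)
    finally show ?thesis by (simp add: D_def algebra_simps)
  qed
  \<comment> \<open>The maximum covers the indices up to \<open>j + n\<close>; a larger index can be
    lowered by \<open>n\<close> without falling below \<open>j\<close>.\<close>
  define C where "C = Max ((\<lambda>k. \<bar>D k\<bar>) ` {..j+n})"
  have C: "\<bar>D k\<bar> \<le> C" for k
  proof (induction k rule: less_induct)
    case (less k)
    show ?case
    proof (cases "k \<le> j + n")
      case True
      then show ?thesis by (auto simp: C_def)
    next
      case False
      then show ?thesis using less[of "k - n"] D[of "k - n"] n by simp
    qed
  qed
  have "liminf (\<lambda>k. ereal ((\<Sum>t<k. f t) / real k)) \<le> ereal l"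
    by (rule liminf_average_le[of _ _ C]) (use C in \<open>auto simp: D_def abs_le_iff algebra_simps\<close>)
  moreover have "liminf (\<lambda>k. ereal ((\<Sum>t<k. f t) / real k)) \<ge> ereal l"
    by (rule liminf_average_ge[of _ C])
      (use C in \<open>force simp: D_def abs_le_iff algebra_simps\<close>)
  ultimately show ?thesis by (simp add: l_def)
qed

section \<open>Optimal walks in finite weighted graphs\<close>

definition walk_from :: "('s \<times> 's) set \<Rightarrow> 's \<Rightarrow> (nat \<Rightarrow> 's) \<Rightarrow> bool" where
  "walk_from E s p \<longleftrightarrow> p 0 = s \<and> (\<forall>k. (p k, p (Suc k)) \<in> E)"

definition walk_weight :: "('s \<times> 's \<Rightarrow> int) \<Rightarrow> (nat \<Rightarrow> 's) \<Rightarrow> nat \<Rightarrow> int" where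
  "walk_weight w p k = (\<Sum>t<k. w (p t, p (Suc t)))"

text \<open>Prepares an induction on the length of a walk: the weight of a long prefix is that of a
  shorter prefix of another walk plus the weight of one cycle.\<close>

lemma walk_remove_cycle:
  assumes p: "walk_from E s p" and eq: "p i = p (i + n)"
  defines "q \<equiv> \<lambda>t. if t \<le> i then p t else p (t + n)"
  shows "walk_from E s q"
    and "i \<le> k \<Longrightarrow> walk_weight w p (k + n)
      = walk_weight w q k + (\<Sum>t\<in>{i..<i+n}. w (p t, p (Suc t)))"
proof -
  \<comment> \<open>At the seam \<open>t = i\<close>, \<open>eq\<close> allows the step out of
    \<open>p i\<close> to be taken as the step out of \<open>p (i + n)\<close>; so every step of
    \<open>q\<close> is a step of \<open>p\<close>.\<close>
  have q_step: "(q t, q (Suc t)) = (if t < i then (p t, p (Suc t)) else (p (t + n), p (Suc (t + n))))" for t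
    using eq by (auto simp: q_def not_less le_Suc_eq)
  show "walk_from E s q"
    using p q_step by (auto simp: walk_from_def q_def split: if_splits)
  assume "i \<le> k"
  then show "walk_weight w p (k + n)
      = walk_weight w q k + (\<Sum>t\<in>{i..<i+n}. w (p t, p (Suc t)))"
  proof (induction k rule: dec_induct)
    case base
    have "walk_weight w q i = walk_weight w p i"
      by (auto simp: walk_weight_def q_step intro!: sum.cong)
    moreover have "walk_weight w p (i + n) = walk_weight w p i + (\<Sum>t\<in>{i..<i+n}. w (p t, p (Suc t)))"
      unfolding walk_weight_def lessThan_atLeast0 by (rule sum.atLeastLessThan_concat[symmetric]) auto
    ultimately show ?case by simp
  next
    case (step k)
    have "(q k, q (Suc k)) = (p (k + n), p (Suc (k + n)))"
      using q_step[of k] step.hyps by auto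
    then have "walk_weight w q (Suc k) = walk_weight w q k + w (p (k + n), p (Suc (k + n)))"
      unfolding walk_weight_def by (simp only: sum.lessThan_Suc)
    moreover have "walk_weight w p (Suc k + n) = walk_weight w p (k + n) + w (p (k + n), p (Suc (k + n)))"
      by (simp add: walk_weight_def)
    ultimately show ?case using step.IH by simp
  qed
qed

lemma optimal_walk_exists:
  fixes w :: "'s \<times> 's \<Rightarrow> int"
  assumes E: "E \<subseteq> S \<times> S" "finite S" and ex: "walk_from E s p0"
  shows "\<exists>p. walk_from E s p \<and> (\<forall>q. walk_from E s q \<longrightarrow>
      liminf (\<lambda>k. ereal (real_of_int (walk_weight w q k) / real k))
      \<le> liminf (\<lambda>k. ereal (real_of_int (walk_weight w p k) / real k)))"
proof -
  define N where "N = card S"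
  \<comment> \<open>Cycles are taken as segments of walks from \<open>s\<close>, which makes them
    reachable by definition. They need not be simple; the length bound \<open>N\<close> is what
    keeps the set \<open>L\<close> of their means finite.\<close>
  define cyc where "cyc q i n \<longleftrightarrow> walk_from E s q \<and> 1 \<le> n \<and> n \<le> N \<and> q i = q (i + n)" for q i n
  define seg where "seg q i n = (\<Sum>t\<in>{i..<i+n}. w (q t, q (Suc t)))" for q i n
  define L where "L = {real_of_int (seg q i n) / real n | q i n. cyc q i n}"
  define W where "W = (\<Sum>e\<in>E. \<bar>w e\<bar>)"
  have W0: "W \<ge> 0" by (simp add: W_def sum_nonneg)
  have finE: "finite E" using E finite_subset by blast
  have W: "\<bar>w e\<bar> \<le> W" if "e \<in> E" for e
    unfolding W_def by (rule member_le_sum[of e E "\<lambda>e. \<bar>w e\<bar>"]) (use that finE in auto)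
  have inS: "q t \<in> S" if "walk_from E s q" for q t
    using that E(1) by (force simp: walk_from_def)
  have wle: "\<bar>w (q t, q (Suc t))\<bar> \<le> W" if "walk_from E s q" for q t
    using that W by (simp add: walk_from_def)
  \<comment> \<open>Pigeonhole on the \<open>N + 1\<close> positions \<open>0..N\<close>. The bound
    \<open>i + n \<le> N\<close> places the cycle inside every prefix of length above
    \<open>N\<close>.\<close>
  have short_cycle: "\<exists>i n. cyc q i n \<and> i + n \<le> N" if q: "walk_from E s q" for q
  proof -
    have "q ` {..N} \<subseteq> S" using inS[OF q] by auto
    then have "card (q ` {..N}) < card {..N}"
      using card_mono[OF E(2), of "q ` {..N}"] by (simp add: N_def)
    then have "\<not> inj_on q {..N}" by (rule pigeonhole)
    then obtain a b where "a \<le> N" "b \<le> N" "a < b" "q a = q b"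
      by (metis atMost_iff linorder_inj_onI')
    then have "cyc q a (b - a) \<and> a + (b - a) \<le> N" using q by (auto simp: cyc_def)
    then show ?thesis by blast
  qed
  have seg_bound: "\<bar>seg q i n\<bar> \<le> int N * W" if "cyc q i n" for q i n
  proof -
    have "\<bar>seg q i n\<bar> \<le> (\<Sum>t\<in>{i..<i+n}. \<bar>w (q t, q (Suc t))\<bar>)"
      unfolding seg_def by (rule sum_abs)
    also have "\<dots> \<le> (\<Sum>t\<in>{i..<i+n}. W)"
      by (rule sum_mono) (use wle that in \<open>auto simp: cyc_def\<close>)
    also have "\<dots> \<le> int N * W"
      using that W0 by (simp add: cyc_def mult_right_mono)
    finally show ?thesis .
  qed
  \<comment> \<open>Weights are integers, so only finitely many numerators and denominators
    occur.\<close>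
  have "L \<subseteq> (\<lambda>(a, n). real_of_int a / real n) ` ({- (int N * W)..int N * W} \<times> {..N})"
  proof
    fix x assume "x \<in> L"
    then obtain q i n where c: "cyc q i n" "x = real_of_int (seg q i n) / real n"
      by (auto simp: L_def)
    then have "(seg q i n, n) \<in> {- (int N * W)..int N * W} \<times> {..N}"
      using seg_bound[OF c(1)] by (auto simp: abs_le_iff cyc_def)
    then show "x \<in> (\<lambda>(a, n). real_of_int a / real n) ` ({- (int N * W)..int N * W} \<times> {..N})"
      by (rule rev_image_eqI) (simp add: c(2))
  qed
  then have finL: "finite L" by (rule finite_subset) simp
  have "L \<noteq> {}" using short_cycle[OF ex] by (auto simp: L_def)
  define l where "l = Max L"
  have "l \<in> L" unfolding l_def using finL \<open>L \<noteq> {}\<close> by (rule Max_in)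
  then obtain q0 i0 n0 where c0: "cyc q0 i0 n0" and l: "l = real_of_int (seg q0 i0 n0) / real n0"
    by (auto simp: L_def)
  have segle: "real_of_int (seg q i n) \<le> l * real n" if "cyc q i n" for q i n
  proof -
    have "real_of_int (seg q i n) / real n \<le> l"
      unfolding l_def using finL that by (intro Max_ge) (auto simp: L_def)
    then show ?thesis using that by (simp add: cyc_def field_simps)
  qed
  \<comment> \<open>\<open>C\<close> absorbs the base case \<open>k \<le> N\<close>: the weight is
    then at most \<open>k * W\<close>, while \<open>l * k\<close> may be as low as
    \<open>- k * \<bar>l\<bar>\<close>.\<close>
  define C where "C = real N * (real_of_int W + \<bar>l\<bar>)"
  have upper: "real_of_int (walk_weight w q k) \<le> l * real k + C" if "walk_from E s q" for q k
    using that
  proof (induction k arbitrary: q rule: less_induct)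
    case (less k)
    show ?case
    proof (cases "k \<le> N")
      case True
      have "walk_weight w q k \<le> (\<Sum>t<k. W)"
        unfolding walk_weight_def
        by (rule sum_mono) (use wle[OF less.prems] in \<open>auto simp: abs_le_iff\<close>)
      then have "real_of_int (walk_weight w q k) \<le> real_of_int (int k * W)"
        by (simp only: of_int_le_iff sum_constant card_lessThan of_nat_id)
      also have "\<dots> = real k * real_of_int W" by simp
      also have "\<dots> \<le> real k * (real_of_int W + \<bar>l\<bar>) + l * real k"
        using mult_left_mono[OF abs_ge_minus_self of_nat_0_le_iff, of k l] by (simp add: algebra_simps)
      also have "\<dots> \<le> l * real k + C"
        using True W0 by (simp add: C_def mult_right_mono)
      finally show ?thesis .
    next
      case False
      obtain i n where c: "cyc q i n" "i + n \<le> N" using short_cycle[OF less.prems] by blast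
      \<comment> \<open>cutting out a cycle leaves an infinite walk from the same state, so the induction
        hypothesis applies without any reachability argument\<close>
      define q' where "q' = (\<lambda>t. if t \<le> i then q t else q (t + n))"
      have qi: "q i = q (i + n)" using c by (simp add: cyc_def)
      note rem = walk_remove_cycle[OF less.prems qi, folded q'_def]
      have n: "0 < n" "n \<le> k" "i \<le> k - n" using c False by (auto simp: cyc_def)
      have "walk_weight w q k = walk_weight w q' (k - n) + seg q i n"
        using rem(2)[of "k - n" w] n by (simp add: seg_def)
      moreover have "real_of_int (walk_weight w q' (k - n)) \<le> l * real (k - n) + C"
        using less.IH[of "k - n" q'] rem(1) n by simp
      ultimately show ?thesis
        using segle[OF c(1)] n by (simp add: of_nat_diff algebra_simps)
    qed
  qed
  have n0: "0 < n0" and q0: "walk_from E s q0" and q0i: "q0 (i0 + n0) = q0 i0"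
    using c0 by (auto simp: cyc_def)
  \<comment> \<open>The lasso: \<open>q0\<close> up to \<open>i0\<close>, then its best cycle
    repeated forever.\<close>
  define p where "p t = (if t < i0 then q0 t else q0 (i0 + (t - i0) mod n0))" for t
  have p_low: "p t = q0 t" if "t < i0 + n0" for t
    using that by (auto simp: p_def)
  have p_per: "p (t + n0) = p t" if "i0 \<le> t" for t
  proof -
    have "t + n0 - i0 = n0 + (t - i0)" using that by simp
    then have "(t + n0 - i0) mod n0 = (t - i0) mod n0" by (metis mod_add_self1)
    then show ?thesis using that by (simp only: p_def) simp
  qed
  \<comment> \<open>At \<open>i0 + n0\<close> the index has wrapped around to \<open>i0\<close>,
    where \<open>q0\<close> has the same state; so the step of \<open>p\<close> that closes the
    cycle is also a step of \<open>q0\<close>.\<close>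
  have p_i: "p (i0 + n0) = q0 (i0 + n0)"
    using q0i by (simp add: p_def)
  have p_low': "p t = q0 t" if "t \<le> i0 + n0" for t
    using that p_low p_i by (cases "t = i0 + n0") auto
  have pE: "(p t, p (Suc t)) \<in> E" for t
  proof (induction t rule: less_induct)
    case (less t)
    show ?case
    proof (cases "t < i0 + n0")
      case True
      then show ?thesis using q0 by (simp add: p_low' walk_from_def)
    next
      case False
      then have "p t = p (t - n0)" "p (Suc t) = p (Suc (t - n0))"
        using p_per[of "t - n0"] p_per[of "Suc (t - n0)"] by (auto simp: le_diff_conv2)
      then show ?thesis using less[of "t - n0"] n0 False by simp
    qed
  qed
  have walk_p: "walk_from E s p"
    using pE p_low'[of 0] q0 by (simp add: walk_from_def)
  define f where "f t = real_of_int (w (p t, p (Suc t)))" for t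
  have "sum f {i0..<i0+n0} = real_of_int (seg q0 i0 n0)"
    by (auto simp: f_def seg_def p_low' intro!: sum.cong)
  moreover have "f (t + n0) = f t" if "i0 \<le> t" for t
    using p_per[of t] p_per[of "Suc t"] that by (simp add: f_def)
  ultimately have "liminf (\<lambda>k. ereal ((\<Sum>t<k. f t) / real k)) = ereal l"
    using liminf_average_periodic[of i0 f n0] n0 by (simp add: l)
  then have opt: "liminf (\<lambda>k. ereal (real_of_int (walk_weight w p k) / real k)) = ereal l"
    by (simp add: f_def walk_weight_def)
  show ?thesis
  proof (intro exI[of _ p] conjI allI impI walk_p)
    fix q assume "walk_from E s q"
    then show "liminf (\<lambda>k. ereal (real_of_int (walk_weight w q k) / real k))
      \<le> liminf (\<lambda>k. ereal (real_of_int (walk_weight w p k) / real k))"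
      unfolding opt by (rule liminf_average_le[OF upper])
  qed
qed

section \<open>Plays consistent with a strategy\<close>

lemma MP_eq: "MP G i \<pi> = liminf (\<lambda>k. ereal (real_of_int (walk_weight (wt G i) \<pi> k) / real k))"
proof -
  have "hist_wt G i (prefix_of \<pi> k) = walk_weight (wt G i) \<pi> k" for k
    by (auto simp: hist_wt_def walk_weight_def prefix_of_def simp del: upt_Suc intro!: sum.cong)
  then show ?thesis by (simp add: MP_def)
qed

text \<open>For a vertex of an arena and a strategy \<open>\<sigma>\<^sub>0\<close>, these are
  exactly the outcomes against \<open>\<sigma>\<^sub>0\<close>, by \<open>Out_consistent\<close> and
  \<open>realizing_strategy\<close>. Best responses can thus be studied in terms of plays
  alone.\<close>

definition consistent :: "'v bi_arena \<Rightarrow> ('v list \<Rightarrow> 'v) \<Rightarrow> 'v \<Rightarrow> (nat \<Rightarrow> 'v) set" where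
  "consistent G \<sigma>\<^sub>0 v = {\<pi>. play G \<pi> \<and> \<pi> 0 = v \<and> follows G P0 \<sigma>\<^sub>0 \<pi>}"

lemma Out_consistent:
  assumes "arena G" "v \<in> verts G" "\<sigma>\<^sub>0 \<in> strategies G P0" "\<sigma>\<^sub>1 \<in> strategies G P1"
  shows "Out G v \<sigma>\<^sub>0 \<sigma>\<^sub>1 \<in> consistent G \<sigma>\<^sub>0 v"
  using Out_is_outcome[OF assms] by (simp add: is_outcome_def consistent_def)

lemma prefix_in_histories: "play G \<pi> \<Longrightarrow> prefix_of \<pi> k \<in> histories G"
  by (auto simp: histories_def)

lemma strategies_nonempty:
  assumes "arena G"
  shows "strategies G i \<noteq> {}"
proof -
  have "\<exists>u. (last h, u) \<in> edges G" if h: "h \<in> histories_of G i" for h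
  proof -
    obtain \<pi> k where "h = prefix_of \<pi> k" "play G \<pi>"
      using h unfolding histories_of_def histories_def by blast
    then show ?thesis by (auto simp: play_def)
  qed
  then show ?thesis by (auto simp: strategies_def PiE_eq_empty_iff)
qed

lemma consistent_nonempty:
  assumes "arena G" "v \<in> verts G" "\<sigma>\<^sub>0 \<in> strategies G P0"
  shows "consistent G \<sigma>\<^sub>0 v \<noteq> {}"
  using Out_consistent[OF assms] strategies_nonempty[OF assms(1), of P1] by blast

lemma realizing_strategy:
  assumes G: "arena G" and s0: "\<sigma>\<^sub>0 \<in> strategies G P0"
    and p: "\<And>v. v \<in> verts G \<Longrightarrow> p v \<in> consistent G \<sigma>\<^sub>0 v"
  shows "\<exists>\<sigma>\<^sub>1\<in>strategies G P1. \<forall>v\<in>verts G. Out G v \<sigma>\<^sub>0 \<sigma>\<^sub>1 = p v"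
proof -
  obtain \<tau> where \<tau>: "\<tau> \<in> strategies G P1" using strategies_nonempty[OF G] by blast
  \<comment> \<open>The first vertex of a history tells which play to continue, and its length is
    the index of the next vertex. Histories off that play get the move of an arbitrary strategy
    \<open>\<tau>\<close>, which is also \<open>undefined\<close> outside the domain as
    required.\<close>
  define \<sigma> where "\<sigma> h = (if h \<in> histories_of G P1 \<and> hd h \<in> verts G
      \<and> h = prefix_of (p (hd h)) (length h - 1) then p (hd h) (length h) else \<tau> h)" for h
  have "\<sigma> \<in> strategies G P1"
    unfolding strategies_def
  proof (rule PiE_I)
    fix h assume h: "h \<in> histories_of G P1"
    show "\<sigma> h \<in> {u. (last h, u) \<in> edges G}"
    proof (cases "hd h \<in> verts G \<and> h = prefix_of (p (hd h)) (length h - 1)")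
      case True
      have "length h > 0" using h by (auto simp: histories_of_def histories_def prefix_of_def)
      moreover have "last h = p (hd h) (length h - 1)" using True last_prefix_of by metis
      moreover have "play G (p (hd h))" using True p by (simp add: consistent_def)
      ultimately have "(last h, p (hd h) (length h)) \<in> edges G"
        by (metis Suc_diff_1 play_def)
      then show ?thesis using True h by (simp add: \<sigma>_def)
    next
      case False
      then show ?thesis using strategy_step[OF \<tau> h] by (auto simp: \<sigma>_def)
    qed
  next
    fix h assume "h \<notin> histories_of G P1"
    then show "\<sigma> h = undefined"
      using \<tau> by (auto simp: \<sigma>_def strategies_def)
  qed
  moreover have "Out G v \<sigma>\<^sub>0 \<sigma> = p v" if v: "v \<in> verts G" for v
  proof -
    have pv: "play G (p v)" "p v 0 = v" "follows G P0 \<sigma>\<^sub>0 (p v)"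
      using p[OF v] by (auto simp: consistent_def)
    have hd: "hd (prefix_of (p v) k) = v" "length (prefix_of (p v) k) = Suc k" for k
      using pv(2) by (simp_all add: prefix_of_def hd_map del: upt_Suc)
    have "follows G P1 \<sigma> (p v)"
      using prefix_in_histories[OF pv(1)] v
      by (auto simp: follows_def \<sigma>_def hd histories_of_def)
    then have "is_outcome G v \<sigma>\<^sub>0 \<sigma> (p v)" using pv by (simp add: is_outcome_def)
    then show ?thesis
      using outcome_unique[OF G] Out_is_outcome[OF G v s0 \<open>\<sigma> \<in> strategies G P1\<close>] by blast
  qed
  ultimately show ?thesis by blast
qed

text \<open>Replaces the search for one strategy that is good from all vertices by a separate
  optimization over plays for each vertex. As \<open>\<epsilon>\<close> is any real,
  \<open>\<epsilon> = 0\<close> covers exact best responses.\<close>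

lemma BR1_eps_nonempty_iff:
  assumes G: "arena G" and s0: "\<sigma>\<^sub>0 \<in> strategies G P0"
  shows "BR1_eps G \<epsilon> \<sigma>\<^sub>0 \<noteq> {} \<longleftrightarrow>
    (\<forall>v\<in>verts G. \<exists>\<pi>\<in>consistent G \<sigma>\<^sub>0 v. \<forall>\<rho>\<in>consistent G \<sigma>\<^sub>0 v.
       MP G P1 \<pi> \<ge> MP G P1 \<rho> - ereal \<epsilon>)" (is "?L \<longleftrightarrow> ?R")
proof
  assume ?L
  then obtain \<sigma>\<^sub>1 where s1: "\<sigma>\<^sub>1 \<in> BR1_eps G \<epsilon> \<sigma>\<^sub>0" by blast
  then have s1': "\<sigma>\<^sub>1 \<in> strategies G P1" by (simp add: BR1_eps_def)
  show ?R
  proof (intro ballI bexI)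
    fix v \<rho> assume v: "v \<in> verts G" and \<rho>: "\<rho> \<in> consistent G \<sigma>\<^sub>0 v"
    \<comment> \<open>A deviation at \<open>v\<close> only: \<open>realizing_strategy\<close> asks
      for a play from every vertex, so the outcomes of \<open>\<sigma>\<^sub>1\<close> are kept
      elsewhere.\<close>
    have "\<exists>\<sigma>\<^sub>1'\<in>strategies G P1. \<forall>u\<in>verts G. Out G u \<sigma>\<^sub>0 \<sigma>\<^sub>1'
        = (if u = v then \<rho> else Out G u \<sigma>\<^sub>0 \<sigma>\<^sub>1)"
      by (rule realizing_strategy[OF G s0]) (use \<rho> Out_consistent[OF G _ s0 s1'] in auto)
    then obtain \<sigma>\<^sub>1' where "\<sigma>\<^sub>1' \<in> strategies G P1" "Out G v \<sigma>\<^sub>0 \<sigma>\<^sub>1' = \<rho>"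
      using v by auto
    then show "MP G P1 (Out G v \<sigma>\<^sub>0 \<sigma>\<^sub>1) \<ge> MP G P1 \<rho> - ereal \<epsilon>"
      using s1 v by (auto simp: BR1_eps_def)
  qed (use Out_consistent[OF G _ s0 s1'] in auto)
next
  assume ?R
  then obtain p where p: "\<And>v. v \<in> verts G \<Longrightarrow> p v \<in> consistent G \<sigma>\<^sub>0 v"
    "\<And>v \<rho>. v \<in> verts G \<Longrightarrow> \<rho> \<in> consistent G \<sigma>\<^sub>0 v \<Longrightarrow> MP G P1 (p v) \<ge> MP G P1 \<rho> - ereal \<epsilon>"
    by metis
  obtain \<sigma>\<^sub>1 where "\<sigma>\<^sub>1 \<in> strategies G P1" "\<And>v. v \<in> verts G \<Longrightarrow> Out G v \<sigma>\<^sub>0 \<sigma>\<^sub>1 = p v"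
    using realizing_strategy[OF G s0, of p] p(1) by blast
  then have "\<sigma>\<^sub>1 \<in> BR1_eps G \<epsilon> \<sigma>\<^sub>0"
    using p(2) Out_consistent[OF G _ s0] by (simp add: BR1_eps_def)
  then show ?L by blast
qed

lemma BR1_eq_BR1_eps: "BR1 G \<sigma>\<^sub>0 = BR1_eps G 0 \<sigma>\<^sub>0"
  by (simp add: BR1_def BR1_eps_def flip: zero_ereal_def)

section \<open>Approximate best responses\<close>

text \<open>Serves to make the supremum of the payoffs finite: an average stays within any bound on
  the single weights, and the sum of all absolute weights is such a bound.\<close>

lemma MP_bounded:
  assumes "arena G"
  shows "\<exists>B. \<forall>\<pi>. play G \<pi> \<longrightarrow> ereal (- B) \<le> MP G i \<pi> \<and> MP G i \<pi> \<le> ereal B"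
proof -
  define W where "W = (\<Sum>e\<in>edges G. \<bar>wt G i e\<bar>)"
  have fin: "finite (edges G)"
    using assms by (auto simp: arena_def intro: finite_subset)
  have "ereal (- real_of_int W) \<le> MP G i \<pi> \<and> MP G i \<pi> \<le> ereal (real_of_int W)" if "play G \<pi>" for \<pi>
  proof -
    have W: "\<bar>wt G i (\<pi> k, \<pi> (Suc k))\<bar> \<le> W" for k
      using that fin by (auto simp: W_def play_def intro: member_le_sum)
    have "\<bar>walk_weight (wt G i) \<pi> k\<bar> \<le> W * int k" for k
    proof -
      have "\<bar>walk_weight (wt G i) \<pi> k\<bar> \<le> (\<Sum>t<k. \<bar>wt G i (\<pi> t, \<pi> (Suc t))\<bar>)"
        unfolding walk_weight_def by (rule sum_abs)
      also have "\<dots> \<le> (\<Sum>t<k. W)" by (rule sum_mono) (rule W)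
      finally show ?thesis by (simp add: mult.commute)
    qed
    then have "\<bar>real_of_int (walk_weight (wt G i) \<pi> k)\<bar> \<le> real_of_int W * real k" for k
      by (metis of_int_abs of_int_le_iff of_int_mult of_int_of_nat_eq)
    then have *: "real_of_int (walk_weight (wt G i) \<pi> k) \<le> real_of_int W * real k + 0"
      "real_of_int (walk_weight (wt G i) \<pi> k) \<ge> - real_of_int W * real k - 0" for k
      by (auto simp: abs_le_iff) (metis minus_le_iff)
    show ?thesis
      unfolding MP_eq using liminf_average_le[OF *(1)] liminf_average_ge[OF *(2)] by simp
  qed
  then show ?thesis by blast
qed

lemma BR1_eps_nonempty:
  assumes G: "arena G" and s0: "\<sigma>\<^sub>0 \<in> strategies G P0" and \<epsilon>: "\<epsilon> > 0"
  shows "BR1_eps G \<epsilon> \<sigma>\<^sub>0 \<noteq> {}"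
  unfolding BR1_eps_nonempty_iff[OF G s0]
proof
  fix v assume v: "v \<in> verts G"
  let ?C = "consistent G \<sigma>\<^sub>0 v"
  obtain B where B: "\<And>\<pi>. play G \<pi> \<Longrightarrow> ereal (- B) \<le> MP G P1 \<pi> \<and> MP G P1 \<pi> \<le> ereal B"
    using MP_bounded[OF G] by blast
  define s where "s = (SUP \<pi>\<in>?C. MP G P1 \<pi>)"
  obtain \<pi>0 where \<pi>0: "\<pi>0 \<in> ?C" using consistent_nonempty[OF G v s0] by blast
  have "s \<le> ereal B" unfolding s_def
    by (rule SUP_least) (use B in \<open>auto simp: consistent_def\<close>)
  moreover have "ereal (- B) \<le> s"
    unfolding s_def using \<pi>0 B by (intro SUP_upper2[of \<pi>0]) (auto simp: consistent_def)
  ultimately obtain r where r: "s = ereal r" by (cases s) auto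
  \<comment> \<open>Finiteness of \<open>s\<close> matters here: subtracting
    \<open>\<epsilon>\<close> from an infinite value would not decrease it.\<close>
  have "s - ereal \<epsilon> < s" using \<epsilon> by (simp add: r)
  then obtain \<pi> where \<pi>: "\<pi> \<in> ?C" "s - ereal \<epsilon> < MP G P1 \<pi>"
    unfolding s_def less_SUP_iff by blast
  have "MP G P1 \<rho> - ereal \<epsilon> \<le> MP G P1 \<pi>" if "\<rho> \<in> ?C" for \<rho>
  proof -
    have "MP G P1 \<rho> \<le> s" unfolding s_def using that by (rule SUP_upper)
    then have "MP G P1 \<rho> - ereal \<epsilon> \<le> s - ereal \<epsilon>" by (intro ereal_minus_mono) auto
    then show ?thesis using \<pi>(2) by order
  qed
  then show "\<exists>\<pi>\<in>?C. \<forall>\<rho>\<in>?C. MP G P1 \<rho> - ereal \<epsilon> \<le> MP G P1 \<pi>" using \<pi>(1) by blast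
qed

section \<open>Finite memory\<close>

lemma butlast_prefix_of: "butlast (prefix_of \<pi> k) = map \<pi> [0..<k]"
  by (simp add: prefix_of_def)

lemma BR1_finite_memory_nonempty:
  assumes G: "arena G" and s0: "\<sigma>\<^sub>0 \<in> strategies G P0" and fm: "finite_memory G P0 \<sigma>\<^sub>0"
  shows "BR1 G \<sigma>\<^sub>0 \<noteq> {}"
  unfolding BR1_eq_BR1_eps BR1_eps_nonempty_iff[OF G s0]
proof
  fix v assume v: "v \<in> verts G"
  obtain M :: "nat set" and m0 upd out where M: "finite M" "m0 \<in> M"
    "\<And>m u. m \<in> M \<Longrightarrow> u \<in> verts G \<Longrightarrow> upd m u \<in> M"
    and out: "\<And>h. h \<in> histories_of G P0 \<Longrightarrow> \<sigma>\<^sub>0 h = out (foldl upd m0 (butlast h)) (last h)"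
    using fm unfolding finite_memory_def by blast
  \<comment> \<open>The product graph. A state pairs the current vertex with the memory before that
    vertex is read, in line with \<open>butlast\<close> in \<open>finite_memory\<close>; hence an
    edge updates the memory with its source \<open>u\<close>.\<close>
  define E where "E = {((m, u), (upd m u, u')) | m u u'. m \<in> M \<and> (u, u') \<in> edges G
      \<and> (u \<in> owned G P0 \<longrightarrow> u' = out m u)}"
  define lift where "lift \<pi> k = (foldl upd m0 (map \<pi> [0..<k]), \<pi> k)" for \<pi> :: "nat \<Rightarrow> 'a" and k
  define w where "w = (\<lambda>((m :: nat, u), (m' :: nat, u')). wt G P1 (u, u'))"
  have E: "E \<subseteq> (M \<times> verts G) \<times> (M \<times> verts G)"
    using M(3) G by (auto simp: E_def arena_def)
  have lift_Suc: "lift \<pi> (Suc k) = (upd (fst (lift \<pi> k)) (\<pi> k), \<pi> (Suc k))" for \<pi> k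
    by (simp add: lift_def)
  have \<sigma>_out: "\<sigma>\<^sub>0 (prefix_of \<pi> k) = out (fst (lift \<pi> k)) (\<pi> k)"
    if "play G \<pi>" "\<pi> k \<in> owned G P0" for \<pi> k
    using out[of "prefix_of \<pi> k"] prefix_in_histories[OF that(1)] that(2)
    by (simp add: histories_of_def lift_def butlast_prefix_of)
  have walk_lift: "walk_from E (m0, v) (lift \<pi>)" if \<pi>: "\<pi> \<in> consistent G \<sigma>\<^sub>0 v" for \<pi>
  proof -
    have pl: "play G \<pi>" "\<pi> 0 = v" "follows G P0 \<sigma>\<^sub>0 \<pi>" using \<pi> by (auto simp: consistent_def)
    have "\<pi> k \<in> verts G" for k using pl(1) G by (auto simp: play_def arena_def)
    then have inM: "fst (lift \<pi> k) \<in> M" for k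
      by (induction k) (auto simp: lift_def M)
    have "(lift \<pi> k, lift \<pi> (Suc k)) \<in> E" for k
    proof -
      have "lift \<pi> k = (fst (lift \<pi> k), \<pi> k)" by (simp add: lift_def)
      moreover have "(\<pi> k, \<pi> (Suc k)) \<in> edges G" using pl(1) by (simp add: play_def)
      moreover have "\<pi> k \<in> owned G P0 \<longrightarrow> \<pi> (Suc k) = out (fst (lift \<pi> k)) (\<pi> k)"
        using pl(3) \<sigma>_out[OF pl(1)] by (simp add: follows_def)
      ultimately show ?thesis
        unfolding E_def lift_Suc using inM[of k] by (auto intro!: exI[of _ "fst (lift \<pi> k)"])
    qed
    then show ?thesis using pl(2) by (simp add: walk_from_def lift_def)
  qed
  have weight_lift: "walk_weight w (lift \<pi>) k = walk_weight (wt G P1) \<pi> k" for \<pi> k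
    by (simp add: walk_weight_def w_def lift_def)
  \<comment> \<open>The memory evolves deterministically from \<open>m0\<close>, so the vertices
    determine it: lifting and projecting are mutually inverse between consistent plays from
    \<open>v\<close> and walks from \<open>(m0, v)\<close>.\<close>
  have unlift: "snd \<circ> p \<in> consistent G \<sigma>\<^sub>0 v \<and> lift (snd \<circ> p) = p" if p: "walk_from E (m0, v) p" for p
  proof -
    let ?\<pi> = "snd \<circ> p"
    have e: "(p k, p (Suc k)) \<in> E" for k using p by (simp add: walk_from_def)
    have p0: "p 0 = (m0, v)" using p by (simp add: walk_from_def)
    have eq: "lift ?\<pi> k = p k" for k
    proof (induction k)
      case 0
      then show ?case by (simp add: lift_def p0)
    next
      case (Suc k)
      show ?case unfolding lift_Suc Suc.IH using e[of k] by (auto simp: E_def)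
    qed
    have "(snd (p k), snd (p (Suc k))) \<in> edges G" for k
      using e[of k] by (auto simp: E_def)
    then have pl: "play G ?\<pi>" by (simp add: play_def)
    have "?\<pi> (Suc k) = \<sigma>\<^sub>0 (prefix_of ?\<pi> k)" if "?\<pi> k \<in> owned G P0" for k
      unfolding \<sigma>_out[OF pl that] eq using e[of k] that by (auto simp: E_def)
    then show ?thesis
      using pl p0 eq by (auto simp: consistent_def follows_def)
  qed
  obtain \<pi>0 where "\<pi>0 \<in> consistent G \<sigma>\<^sub>0 v" using consistent_nonempty[OF G v s0] by blast
  moreover have "finite (M \<times> verts G)" using M(1) G by (simp add: arena_def)
  ultimately obtain p where p: "walk_from E (m0, v) p"
    and opt: "\<And>q. walk_from E (m0, v) q \<Longrightarrow>
      liminf (\<lambda>k. ereal (real_of_int (walk_weight w q k) / real k))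
      \<le> liminf (\<lambda>k. ereal (real_of_int (walk_weight w p k) / real k))"
    using optimal_walk_exists[OF E, of "(m0, v)" _ w] walk_lift by blast
  \<comment> \<open>Lifting preserves weights, so an optimal walk projects to an optimal
    play.\<close>
  have "MP G P1 \<rho> \<le> MP G P1 (snd \<circ> p)" if "\<rho> \<in> consistent G \<sigma>\<^sub>0 v" for \<rho>
    using opt[OF walk_lift[OF that]] unlift[OF p] weight_lift[of "snd \<circ> p"]
    by (simp add: MP_eq weight_lift)
  then show "\<exists>\<pi>\<in>consistent G \<sigma>\<^sub>0 v. \<forall>\<rho>\<in>consistent G \<sigma>\<^sub>0 v. MP G P1 \<rho> - ereal 0 \<le> MP G P1 \<pi>"
    using unlift[OF p] by (auto simp flip: zero_ereal_def)
qed

section \<open>A strategy without best responses\<close>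

text \<open>Player 1 can wait at 0 and leave only to 1; from then on Player 0 moves between 1 and 2
  forever. A step weighs 1 iff it starts at 1, so what counts is how often 2 is visited.\<close>

definition delay_arena :: "nat bi_arena" where
  "delay_arena = \<lparr>verts = {0, 1, 2}, edges = {(0,0), (0,1), (1,1), (1,2), (2,1), (2,2)},
     owned = (\<lambda>i. case i of P0 \<Rightarrow> {1, 2} | P1 \<Rightarrow> {0}),
     wt = (\<lambda>i (u, _). if u = 1 then 1 else 0)\<rparr>"

text \<open>In a history from 0, the number of zeros is the waiting time \<open>z\<close>, and
  \<open>length h\<close> is the index of the vertex being chosen. So 2 is chosen exactly at the
  multiples of \<open>z + 1\<close>: longer waiting makes it rarer.\<close>

definition delay_strategy :: "nat list \<Rightarrow> nat" where
  "delay_strategy = (\<lambda>h\<in>histories_of delay_arena P0.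
     if Suc (count_list h 0) dvd length h then 2 else 1)"

text \<open>\<open>z\<close> is the number of visits to 0. A play from 0 has \<open>z > 0\<close>;
  the degenerate \<open>delay_play 0\<close> stays at 2.\<close>

definition delay_play :: "nat \<Rightarrow> nat \<Rightarrow> nat" where
  "delay_play z t = (if t < z then 0 else if Suc z dvd t then 2 else 1)"

lemma arena_delay: "arena delay_arena"
  by (auto simp: arena_def delay_arena_def)

lemma delay_strategy: "delay_strategy \<in> strategies delay_arena P0"
proof -
  have "(last h, u) \<in> edges delay_arena" if "h \<in> histories_of delay_arena P0" "u \<in> {1, 2}" for h u
    using that by (auto simp: histories_of_def delay_arena_def)
  then show ?thesis
    unfolding strategies_def delay_strategy_def by (intro restrict_PiE_iff[THEN iffD2] ballI) auto
qed

lemma delay_strategy_prefix: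
  assumes "play delay_arena \<pi>" "\<pi> k \<noteq> 0"
  shows "delay_strategy (prefix_of \<pi> k)
    = (if Suc (count_list (prefix_of \<pi> k) 0) dvd Suc k then 2 else 1)"
proof -
  have "(\<pi> k, \<pi> (Suc k)) \<in> edges delay_arena" using assms(1) by (simp add: play_def)
  then have "\<pi> k \<in> owned delay_arena P0" using assms(2) by (auto simp: delay_arena_def)
  then have "prefix_of \<pi> k \<in> histories_of delay_arena P0"
    using prefix_in_histories[OF assms(1)] by (simp add: histories_of_def)
  then show ?thesis by (simp add: delay_strategy_def prefix_of_def)
qed

lemma count_delay_prefix:
  assumes "\<And>t. t < z \<Longrightarrow> \<pi> t = (0::nat)" "\<And>t. z \<le> t \<Longrightarrow> t \<le> k \<Longrightarrow> \<pi> t \<noteq> 0" "z \<le> k"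
  shows "count_list (prefix_of \<pi> k) 0 = z"
proof -
  have "count_list (map \<pi> [0..<n]) 0 = min n z" if "n \<le> Suc k" for n
    using that
  proof (induction n)
    case (Suc n)
    then show ?case using assms(1)[of n] assms(2)[of n] by (cases "n < z") auto
  qed simp
  from this[of "Suc k"] show ?thesis using assms(3) by (simp add: prefix_of_def min_def)
qed

lemma delay_play_consistent:
  assumes z: "z > 0"
  shows "delay_play z \<in> consistent delay_arena delay_strategy 0"
proof -
  \<comment> \<open>The vertex at index \<open>z\<close> must be 1, since there is no edge from 0 to
    2.\<close>
  have "\<not> Suc z dvd z" using z by (simp add: nat_dvd_not_less)
  then have "(delay_play z t, delay_play z (Suc t)) \<in> edges delay_arena" for t
    by (cases "Suc t = z") (auto simp: delay_play_def delay_arena_def)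
  then have pl: "play delay_arena (delay_play z)" by (simp add: play_def)
  have "delay_play z (Suc k) = delay_strategy (prefix_of (delay_play z) k)"
    if "delay_play z k \<in> owned delay_arena P0" for k
  proof -
    have nz: "delay_play z k \<noteq> 0" using that by (auto simp: delay_arena_def)
    then have k: "z \<le> k" by (simp add: delay_play_def split: if_splits)
    have "count_list (prefix_of (delay_play z) k) 0 = z"
      by (rule count_delay_prefix) (use k in \<open>auto simp: delay_play_def\<close>)
    moreover have "delay_play z (Suc k) = (if Suc z dvd Suc k then 2 else 1)"
      using k by (simp add: delay_play_def)
    ultimately show ?thesis
      using delay_strategy_prefix[OF pl nz] by simp
  qed
  then show ?thesis using pl z by (simp add: consistent_def follows_def delay_play_def)
qed

text \<open>Vertex 0 cannot be entered again and all other moves are Player 0's, so a play from 0 is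
  determined by the time at which it leaves 0.\<close>

lemma consistent_delay_cases:
  assumes "\<pi> \<in> consistent delay_arena delay_strategy 0"
  obtains "\<And>t. \<pi> t = 0" | z where "z > 0" "\<pi> = delay_play z"
proof (cases "\<forall>t. \<pi> t = 0")
  case False
  define z where "z = (LEAST t. \<pi> t \<noteq> 0)"
  have nz: "\<pi> z \<noteq> 0" unfolding z_def using False by (metis (mono_tags) LeastI)
  have lt: "\<pi> t = 0" if "t < z" for t using that not_less_Least unfolding z_def by blast
  have pl: "play delay_arena \<pi>" and \<pi>0: "\<pi> 0 = 0" and fol: "follows delay_arena P0 delay_strategy \<pi>"
    using assms by (auto simp: consistent_def)
  have e: "(\<pi> t, \<pi> (Suc t)) \<in> edges delay_arena" for t using pl by (simp add: play_def)
  have z: "z > 0" using nz \<pi>0 by (metis gr0I)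
  have ndvd: "\<not> Suc z dvd z" using z by (simp add: nat_dvd_not_less)
  have ge: "\<pi> t \<noteq> 0" if "z \<le> t" for t
    using that
  proof (induction t rule: dec_induct)
    case (step t)
    then show ?case using e[of t] by (auto simp: delay_arena_def)
  qed (rule nz)
  \<comment> \<open>Index \<open>z\<close> is reached by a move of Player 1, whose only exit leads
    to 1; the later vertices are chosen by \<open>delay_strategy\<close>.\<close>
  have "\<pi> t = delay_play z t" for t
  proof (cases "t \<le> z")
    case True
    have "\<pi> z = 1" using e[of "z - 1"] lt[of "z - 1"] nz z by (auto simp: delay_arena_def)
    then show ?thesis using True lt ndvd by (auto simp: delay_play_def le_less)
  next
    case False
    then obtain k where k: "t = Suc k" "z \<le> k" by (cases t) auto
    have "\<pi> k \<noteq> 0" using ge k by blast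
    moreover have "\<pi> k \<in> owned delay_arena P0" using calculation e[of k] by (auto simp: delay_arena_def)
    moreover have "count_list (prefix_of \<pi> k) 0 = z"
      by (rule count_delay_prefix) (use lt ge k in auto)
    ultimately show ?thesis
      using fol delay_strategy_prefix[OF pl] k by (simp add: follows_def delay_play_def)
  qed
  then show ?thesis using that(2)[OF z] by blast
next
  case True
  then show ?thesis using that(1) by simp
qed

text \<open>From index \<open>z + 1\<close> on, the weights have period \<open>z + 1\<close> with a
  single 0 per period. The window starts at a multiple of \<open>z + 1\<close>, so this 0 is its
  first entry.\<close>

lemma MP_delay_play:
  "MP delay_arena P1 (delay_play z) = ereal (real z / real (Suc z))"
proof -
  define f :: "nat \<Rightarrow> real" where "f t = (if delay_play z t = 1 then 1 else 0)" for t
  have "real_of_int (walk_weight (wt delay_arena P1) (delay_play z) k) = (\<Sum>t<k. f t)" for k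
    by (auto simp: walk_weight_def f_def delay_arena_def intro!: sum.cong)
  then have "MP delay_arena P1 (delay_play z) = liminf (\<lambda>k. ereal ((\<Sum>t<k. f t) / real k))"
    by (simp add: MP_eq)
  also have "\<dots> = ereal (sum f {Suc z..<Suc z + Suc z} / real (Suc z))"
    by (rule liminf_average_periodic) (auto simp: f_def delay_play_def simp del: add_Suc_right add_Suc)
  also have "sum f {Suc z..<Suc z + Suc z} = f (Suc z) + sum f {Suc (Suc z)..<Suc z + Suc z}"
    by (rule sum.atLeast_Suc_lessThan) simp
  also have "sum f {Suc (Suc z)..<Suc z + Suc z} = (\<Sum>t\<in>{Suc (Suc z)..<Suc z + Suc z}. 1)"
  proof (rule sum.cong)
    fix t assume t: "t \<in> {Suc (Suc z)..<Suc z + Suc z}"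
    have "\<not> Suc z dvd t"
    proof
      assume "Suc z dvd t"
      then have "Suc z dvd t - Suc z" by simp
      then show False using t dvd_imp_le[of "Suc z" "t - Suc z"] by auto
    qed
    then show "f t = 1" using t by (simp add: f_def delay_play_def)
  qed simp
  also have "f (Suc z) = 0" by (simp add: f_def delay_play_def)
  finally show ?thesis by simp
qed

text \<open>Every consistent play from 0 is beaten by another: staying at 0 forever, with payoff 0,
  by \<open>delay_play 1\<close>, with payoff 1/2, and \<open>delay_play z\<close> by
  \<open>delay_play (Suc z)\<close>.\<close>

lemma BR1_delay_empty: "BR1 delay_arena delay_strategy = {}"
proof (rule ccontr)
  assume "BR1 delay_arena delay_strategy \<noteq> {}"
  moreover have "0 \<in> verts delay_arena" by (simp add: delay_arena_def)
  ultimately obtain \<pi> where \<pi>: "\<pi> \<in> consistent delay_arena delay_strategy 0"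
    and opt: "\<And>\<rho>. \<rho> \<in> consistent delay_arena delay_strategy 0 \<Longrightarrow>
      MP delay_arena P1 \<rho> \<le> MP delay_arena P1 \<pi>"
    unfolding BR1_eq_BR1_eps BR1_eps_nonempty_iff[OF arena_delay delay_strategy]
    by (auto simp flip: zero_ereal_def)
  from \<pi> show False
  proof (cases rule: consistent_delay_cases)
    case 1
    then have "MP delay_arena P1 \<pi> = 0"
      by (simp add: MP_eq walk_weight_def delay_arena_def Liminf_const flip: zero_ereal_def)
    then show False
      using opt[OF delay_play_consistent[of 1]] by (simp add: MP_delay_play)
  next
    case (2 z)
    then show False
      using opt[OF delay_play_consistent[of "Suc z"]] by (simp add: MP_delay_play field_simps)
  qed
qed

theorem lemma3:
  shows "(\<exists>G :: nat bi_arena. arena G \<and> (\<exists>\<sigma>\<^sub>0\<in>strategies G P0. BR1 G \<sigma>\<^sub>0 = {})) \<and>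
    (\<forall>G :: 'v bi_arena. arena G \<longrightarrow>
       (\<forall>\<sigma>\<^sub>0\<in>strategies G P0. finite_memory G P0 \<sigma>\<^sub>0 \<longrightarrow> BR1 G \<sigma>\<^sub>0 \<noteq> {})) \<and>
    (\<forall>G :: 'v bi_arena. arena G \<longrightarrow>
       (\<forall>\<sigma>\<^sub>0\<in>strategies G P0. \<forall>\<epsilon>>0. BR1_eps G \<epsilon> \<sigma>\<^sub>0 \<noteq> {}))"
proof (intro conjI allI impI ballI)
  show "\<exists>G :: nat bi_arena. arena G \<and> (\<exists>\<sigma>\<^sub>0\<in>strategies G P0. BR1 G \<sigma>\<^sub>0 = {})"
    using arena_delay delay_strategy BR1_delay_empty by auto
qed (simp_all add: BR1_finite_memory_nonempty BR1_eps_nonempty)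

end
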